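(* There exists a homogeneous subspace of $2^\omega$ that is not relatively homogeneous.
   Context: $2^\omega$ is the Cantor set with the product topology. For a space $Z$, $\mathcal{H}(Z)$ denotes the group of homeomorphisms of $Z$ onto itself. A space $X$ is homogeneous if for every pair $(x,y)$ of points of $X$ there exists $h\in\mathcal{H}(X)$ such that $h(x)=y$. A subspace $X$ of $2^\omega$ is relatively homogeneous if for every pair $(x,y)$ of points of $X$ there exists $h\in\mathcal{H}(2^\omega)$ such that $h[X]=X$ and $h(x)=y$. The result is in $\mathsf{ZFC}$. *)

theory Defs
  imports "HOL-Analysis.Analysis"
begin

definition cantor_space :: "(nat \<Rightarrow> bool) topology" where
  "cantor_space = product_topology (\<lambda>_. discrete_topology UNIV) UNIV"

text \<open>Homeomorphisms are total functions here; their values outside the underlying set of the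
  space are irrelevant, both for \<^const>\<open>homeomorphic_map\<close> and for the notions below.\<close>

definition homeos :: "'a topology \<Rightarrow> ('a \<Rightarrow> 'a) set" where
  "homeos Z = {h. homeomorphic_map Z Z h}"

definition homogeneous :: "'a topology \<Rightarrow> bool" where
  "homogeneous Z \<longleftrightarrow>
     (\<forall>x\<in>topspace Z. \<forall>y\<in>topspace Z. \<exists>h\<in>homeos Z. h x = y)"

definition relatively_homogeneous :: "(nat \<Rightarrow> bool) set \<Rightarrow> bool" where
  "relatively_homogeneous X \<longleftrightarrow>
     (\<forall>x\<in>X. \<forall>y\<in>X. \<exists>h\<in>homeos cantor_space. h ` X = X \<and> h x = y)"

end

theory Submission
  imports Defs
begin

text \<open>The witness is the disjoint union \<open>X\<close> of a clopen piece of Cantor space with a nowhere dense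
  copy of Cantor space. The property that defeats relative homogeneity is being an interior point:
  an ambient homeomorphism that preserves \<open>X\<close> also preserves its interior, and so cannot carry a
  point of the clopen piece to a point of the nowhere dense one. Intrinsically the two pieces look
  alike: each is a Cantor set, hence so is \<open>X\<close>
  (\<open>homeomorphic_maps_cantor_half_thin_set\<close>). Since Cantor space is a topological group under
  coordinatewise exclusive or, translations make it homogeneous (\<open>homogeneous_cantor_space\<close>), and
  \<open>X\<close> inherits homogeneity through the homeomorphism.\<close>

lemma topspace_cantor_space [simp]: "topspace cantor_space = UNIV"
  by (simp add: cantor_space_def)

lemma continuous_map_cantor_coordinate:
  "continuous_map cantor_space (discrete_topology UNIV) (\<lambda>x. x i)"
  unfolding cantor_space_def
  by (rule continuous_map_product_projection) simp

lemma continuous_map_into_cantor_space: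
  "continuous_map T cantor_space f \<longleftrightarrow>
     (\<forall>i. continuous_map T (discrete_topology UNIV) (\<lambda>x. f x i))"
  unfolding cantor_space_def by (simp add: continuous_map_componentwise_UNIV)

text \<open>A product of two discrete spaces is discrete, so every map \<open>\<phi>\<close> is continuous on it.\<close>

lemma continuous_map_discrete_combine:
  assumes "continuous_map T (discrete_topology UNIV) p"
    and "continuous_map T (discrete_topology UNIV) q"
  shows "continuous_map T (discrete_topology UNIV) (\<lambda>x. \<phi> (p x) (q x))"
proof -
  have "continuous_map T (discrete_topology UNIV) (\<lambda>x. (p x, q x))"
    using continuous_map_pairedI [OF assms]
    by (simp flip: prod_topology_discrete_topology)
  then have "continuous_map T (discrete_topology UNIV) ((\<lambda>(a, b). \<phi> a b) \<circ> (\<lambda>x. (p x, q x)))"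
    by (rule continuous_map_compose) simp
  then show ?thesis by (simp add: comp_def)
qed

lemma homogeneous_cantor_space: "homogeneous cantor_space"
proof -
  have "\<exists>h\<in>homeos cantor_space. h x = y" for x y :: "nat \<Rightarrow> bool"
  proof -
    \<comment> \<open>Translation by the difference of \<open>x\<close> and \<open>y\<close>, an involution.\<close>
    define h where "h z = (\<lambda>n. z n \<noteq> (x n \<noteq> y n))" for z :: "nat \<Rightarrow> bool"
    have "continuous_map cantor_space cantor_space h"
      unfolding continuous_map_into_cantor_space h_def
    proof
      fix n
      show "continuous_map cantor_space (discrete_topology UNIV) (\<lambda>z. z n \<noteq> (x n \<noteq> y n))"
        by (rule continuous_map_discrete_combine [where \<phi> = "\<lambda>a _. a \<noteq> (x n \<noteq> y n)"
              and p = "\<lambda>z. z n" and q = "\<lambda>z. z n",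
              OF continuous_map_cantor_coordinate continuous_map_cantor_coordinate])
    qed
    moreover have "h (h z) = z" for z
      by (auto simp: h_def)
    ultimately have "homeomorphic_map cantor_space cantor_space h"
      by (intro homeomorphic_maps_imp_map [where g = h]) (simp add: homeomorphic_maps_def)
    moreover have "h x = y"
      by (auto simp: h_def)
    ultimately show ?thesis
      by (auto simp: homeos_def)
  qed
  then show ?thesis
    by (simp add: homogeneous_def)
qed

lemma homogeneous_homeomorphic_maps:
  assumes "homogeneous S" and fg: "homeomorphic_maps S T f g"
  shows "homogeneous T"
  unfolding homogeneous_def
proof (intro ballI)
  fix x y assume x: "x \<in> topspace T" and y: "y \<in> topspace T"
  have f: "homeomorphic_map S T f" and g: "homeomorphic_map T S g"
    using fg homeomorphic_maps_map by blast+
  have "g x \<in> topspace S" "g y \<in> topspace S"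
    using x y homeomorphic_imp_surjective_map [OF g] by auto
  then obtain h where h: "homeomorphic_map S S h" "h (g x) = g y"
    using assms(1) by (auto simp: homogeneous_def homeos_def)
  have "homeomorphic_map T T (f \<circ> (h \<circ> g))"
    by (intro homeomorphic_map_compose [OF _ f] homeomorphic_map_compose [OF g h(1)])
  moreover have "(f \<circ> (h \<circ> g)) x = y"
    using h(2) fg y by (simp add: homeomorphic_maps_def)
  ultimately show "\<exists>h\<in>homeos T. h x = y"
    by (auto simp: homeos_def)
qed

text \<open>Forcing the odd coordinates to be \<^const>\<open>False\<close> makes the second part nowhere dense, while the
  free even coordinates keep it a Cantor set.\<close>

definition half_thin_set :: "(nat \<Rightarrow> bool) set" where
  "half_thin_set = {x. x 0} \<union> {x. \<not> x 0 \<and> (\<forall>n. odd n \<longrightarrow> \<not> x n)}"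

text \<open>Inserting a \<^const>\<open>False\<close> after every entry maps the sequences that start with \<^const>\<open>False\<close>
  homeomorphically onto the thin part. The other half of Cantor space stays fixed; the two maps may
  be glued because both halves are clopen and both maps preserve coordinate \<open>0\<close>.\<close>

lemma homeomorphic_maps_cantor_half_thin_set:
  "homeomorphic_maps cantor_space (subtopology cantor_space half_thin_set)
     (\<lambda>x. if x 0 then x else (\<lambda>n. even n \<and> x (n div 2)))
     (\<lambda>y. if y 0 then y else (\<lambda>n. y (2 * n)))"
    (is "homeomorphic_maps _ _ ?f ?g")
proof -
  \<comment> \<open>Both \<open>?f\<close> and \<open>?g\<close> have this form. Coordinate \<open>n\<close> of the value depends only on the
      coordinates \<open>0\<close>, \<open>n\<close> and \<open>k n\<close> of the argument.\<close>
  have glue: "continuous_map cantor_space cantor_space (\<lambda>x. if x 0 then x else (\<lambda>n. c n \<and> x (k n)))"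
    for c :: "nat \<Rightarrow> bool" and k :: "nat \<Rightarrow> nat"
    unfolding continuous_map_into_cantor_space
  proof
    fix n
    note coord = continuous_map_cantor_coordinate
    have "continuous_map cantor_space (discrete_topology UNIV) (\<lambda>x. (x n, x (k n)))"
      by (rule continuous_map_discrete_combine [where \<phi> = Pair and p = "\<lambda>x. x n"
            and q = "\<lambda>x. x (k n)", OF coord coord])
    with coord [of 0]
    have "continuous_map cantor_space (discrete_topology UNIV)
        (\<lambda>x. if x 0 then fst (x n, x (k n)) else c n \<and> snd (x n, x (k n)))"
      by (rule continuous_map_discrete_combine [where p = "\<lambda>x. x 0" and q = "\<lambda>x. (x n, x (k n))"
            and \<phi> = "\<lambda>a b. if a then fst b else c n \<and> snd b"])
    then show "continuous_map cantor_space (discrete_topology UNIV)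
        (\<lambda>x. (if x 0 then x else (\<lambda>n. c n \<and> x (k n))) n)"
      by (simp only: if_distribR fst_conv snd_conv)
  qed
  have "?f ` UNIV \<subseteq> half_thin_set"
    by (auto simp: half_thin_set_def)
  then have "continuous_map cantor_space (subtopology cantor_space half_thin_set) ?f"
    using glue [of even "\<lambda>n. n div 2"]
    unfolding continuous_map_in_subtopology image_subset_iff_funcset topspace_cantor_space
    by (intro conjI)
  moreover have "continuous_map (subtopology cantor_space half_thin_set) cantor_space ?g"
    using glue [of "\<lambda>_. True" "\<lambda>n. 2 * n"] by (simp only: simp_thms continuous_map_from_subtopology)
  moreover have "?g (?f x) = x" for x
    by auto
  moreover have "?f (?g y) = y" if "y \<in> half_thin_set" for y
  proof (cases "y 0")
    case False
    then have "(even n \<and> y (2 * (n div 2))) = y n" for n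
      using that by (cases "even n") (simp_all add: half_thin_set_def)
    with False show ?thesis
      by simp
  qed simp
  ultimately show ?thesis
    by (simp add: homeomorphic_maps_def)
qed

text \<open>A basic open neighbourhood of the constant sequence \<^const>\<open>False\<close> constrains only
  finitely many coordinates, so it contains a sequence with a single entry \<^const>\<open>True\<close>, at an odd position.\<close>

lemma zero_not_interior_half_thin_set:
  assumes "openin cantor_space W" "(\<lambda>_. False) \<in> W"
  shows "\<not> W \<subseteq> half_thin_set"
proof -
  obtain U where U: "finite {i. U i \<noteq> UNIV}" "(\<lambda>_. False) \<in> Pi\<^sub>E UNIV U" "Pi\<^sub>E UNIV U \<subseteq> W"
    using assms unfolding cantor_space_def openin_product_topology_alt
    by (simp only: topspace_discrete_topology) auto
  have "infinite (range (\<lambda>k::nat. 2 * k + 1))"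
    by (rule range_inj_infinite) (simp add: inj_def)
  then have "\<not> range (\<lambda>k::nat. 2 * k + 1) \<subseteq> {i. U i \<noteq> UNIV}"
    using U(1) by (meson finite_subset)
  then obtain k where "U (2 * k + 1) = UNIV"
    by auto
  then obtain n where n: "odd n" "U n = UNIV"
    using that [of "2 * k + 1"] by simp
  have "(\<lambda>i. i = n) \<in> W"
  proof (rule subsetD [OF U(3)], rule PiE_I)
    show "(i = n) \<in> U i" for i
      using PiE_mem [OF U(2), of i] n(2) by (cases "i = n") simp_all
  qed simp
  moreover have "(\<lambda>i. i = n) \<notin> half_thin_set"
    using n(1) by (auto simp: half_thin_set_def intro: odd_pos)
  ultimately show ?thesis by blast
qed

lemma not_relatively_homogeneous_half_thin_set: "\<not> relatively_homogeneous half_thin_set"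
proof
  assume "relatively_homogeneous half_thin_set"
  moreover have "(\<lambda>_. True) \<in> half_thin_set" "(\<lambda>_. False) \<in> half_thin_set"
    by (auto simp: half_thin_set_def)
  ultimately obtain h where h: "homeomorphic_map cantor_space cantor_space h"
      "h ` half_thin_set = half_thin_set" "h (\<lambda>_. True) = (\<lambda>_. False)"
    unfolding relatively_homogeneous_def homeos_def by blast
  have "openin cantor_space {x \<in> topspace cantor_space. x 0 \<in> {True}}"
    by (rule openin_continuous_map_preimage [OF continuous_map_cantor_coordinate]) simp
  then have "openin cantor_space {x. x 0}"
    by simp
  then have "openin cantor_space (h ` {x. x 0})"
    using homeomorphic_imp_open_map [OF h(1)] by (simp add: open_map_def)
  moreover have "(\<lambda>_. False) \<in> h ` {x. x 0}"
    using h(3) by (intro image_eqI [where x = "\<lambda>_. True"]) simp_all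
  moreover have "h ` {x. x 0} \<subseteq> half_thin_set"
    using h(2) by (auto simp: half_thin_set_def)
  ultimately show False
    using zero_not_interior_half_thin_set by blast
qed

theorem corollary7:
  shows "\<exists>X. X \<subseteq> topspace cantor_space \<and>
           homogeneous (subtopology cantor_space X) \<and>
           \<not> relatively_homogeneous X"
  using homogeneous_homeomorphic_maps
      [OF homogeneous_cantor_space homeomorphic_maps_cantor_half_thin_set]
    not_relatively_homogeneous_half_thin_set
  by auto

end
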